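(* Let $m, N \in \mathbb{N}$, let $y \in \mathbb{C}^m$, let $w \in \mathbb{R}^N$ be a vector of weights with $w_j > 0$ for every $j \in [N]$, and let $\lambda \geq 0$. Let $S \subseteq [N]$, let $A \in \mathbb{C}^{m \times N}$ be a matrix whose columns all have $\ell^2$-norm equal to $1$, and let $x \in \mathbb{C}^N$ satisfy $$ x \in \arg\min_{z \in \mathbb{C}^N} \|y - Az\|_2 \quad \text{s.t.} \quad \operatorname{supp}(z) \subseteq S. $$ Define $G_\lambda : \mathbb{C}^N \to \mathbb{R}$ by $$ G_\lambda(z) := \|y - Az\|_2^2 + \lambda \|z\|_{0,w}. $$ Then, for every $j \in [N]$, the following holds: $$ \min_{t \in \mathbb{C}} G_\lambda(x + t e_j) = G_\lambda(x) - \Delta_\lambda(x,S,j), $$ where $\Delta_\lambda : \mathbb{C}^N \times 2^{[N]} \times [N] \to \mathbb{R}$ is defined by $$ \Delta_\lambda(x,S,j) := \begin{cases} \max\left\{ |(A^*(y-Ax))_j|^2 - \lambda w_j^2, \; 0\right\} & \text{if } j \notin S, \\ \max\left\{\lambda w_j^2 - |x_j|^2, \; 0\right\} & \text{if } j \in S \text{ and } x_j \neq 0,\\ 0 & \text{if } j \in S \text{ and } x_j = 0. \end{cases} $$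
   Context: Notation: $[N] := \{1,\ldots,N\}$, and $2^{[N]}$ is the power set of $[N]$. For $z \in \mathbb{C}^N$, $\operatorname{supp}(z) := \{j \in [N] : z_j \neq 0\}$. The vector $e_j$ is the $j$-th standard basis vector of $\mathbb{C}^N$, $\|\cdot\|_2$ is the Euclidean ($\ell^2$) norm, and $A^*$ is the conjugate transpose of $A$. Given weights $w \in \mathbb{R}^N$ with $w > 0$ componentwise, the weighted $\ell^0$ "norm" of $z \in \mathbb{C}^N$ is $$ \|z\|_{0,w} := \sum_{j \in \operatorname{supp}(z)} w_j^2. $$ The statement asserts in particular that the minimum over $t \in \mathbb{C}$ is attained. *)

theory Defs
  imports "HOL-Analysis.Analysis"
begin

definition supp :: "complex ^ 'n \<Rightarrow> 'n set" where
  "supp z = {j. z $ j \<noteq> 0}"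

definition conj_transpose :: "complex ^ 'n ^ 'm \<Rightarrow> complex ^ 'm ^ 'n" where
  "conj_transpose A = (\<chi> i j. cnj (A $ j $ i))"

definition weighted_l0 :: "real ^ 'n \<Rightarrow> complex ^ 'n::finite \<Rightarrow> real" where
  "weighted_l0 w z = (\<Sum>j\<in>supp z. (w $ j)\<^sup>2)"

definition G :: "complex ^ 'n ^ 'm \<Rightarrow> complex ^ 'm \<Rightarrow> real ^ 'n \<Rightarrow> real
    \<Rightarrow> complex ^ 'n::finite \<Rightarrow> real" where
  "G A y w lam z = (norm (y - A *v z))\<^sup>2 + lam * weighted_l0 w z"

definition \<Delta> :: "complex ^ 'n ^ 'm \<Rightarrow> complex ^ 'm \<Rightarrow> real ^ 'n \<Rightarrow> real
    \<Rightarrow> complex ^ 'n::finite \<Rightarrow> 'n set \<Rightarrow> 'n \<Rightarrow> real" where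
  "\<Delta> A y w lam x S j =
    (if j \<notin> S then
       max ((cmod ((conj_transpose A *v (y - A *v x)) $ j))\<^sup>2 - lam * (w $ j)\<^sup>2) 0
     else if x $ j \<noteq> 0 then
       max (lam * (w $ j)\<^sup>2 - (cmod (x $ j))\<^sup>2) 0
     else 0)"

end

theory Submission
  imports Defs
begin

text \<open>
  Along the line \<open>t \<mapsto> x + t e\<^sub>j\<close> the objective depends on \<open>t\<close> through two terms only.
  Let \<open>c = (A\<^sup>*(y - Ax))\<^sub>j\<close>, the inner product of the residual with the \<open>j\<close>-th column.  Since
  that column has norm one, completing the square turns the quadratic term into
  \<open>\<parallel>y - Ax\<parallel>\<^sup>2 - |c|\<^sup>2 + |t - c|\<^sup>2\<close> (\<open>norm_residual_along_axis\<close>), while the penalty only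
  sees whether \<open>x\<^sub>j + t\<close> vanishes (\<open>weighted_l0_along_axis\<close>).  It remains to minimise
  \<open>|t - c|\<^sup>2 + \<mu> [x\<^sub>j + t \<noteq> 0]\<close> with \<open>\<mu> = \<lambda> w\<^sub>j\<^sup>2\<close>: one either kills the entry (\<open>t = -x\<^sub>j\<close>) at
  cost \<open>|x\<^sub>j + c|\<^sup>2\<close>, or takes the vertex \<open>t = c\<close> of the parabola at cost \<open>\<mu>\<close>, so
  the minimum is \<open>min |x\<^sub>j + c|\<^sup>2 \<mu>\<close> (\<open>hard_threshold_is_arg_min\<close>).

  The hypothesis on \<open>x\<close> specialises this formula.  If \<open>j \<notin> S\<close> then \<open>x\<^sub>j = 0\<close>.  If \<open>j \<in> S\<close> then
  \<open>c = 0\<close>, because the step \<open>t = c\<close> stays feasible and lowers the squared residual by \<open>|c|\<^sup>2\<close>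
  (\<open>least_squares_orthogonal\<close>).  The three cases of \<open>\<Delta>\<close> are then read off.
\<close>

text \<open>Completing the square in a complex scalar: with a unit vector \<open>a\<close>, the point of the
  line spanned by \<open>a\<close> closest to \<open>r\<close> has coefficient \<open>h\<close>, the Hermitian inner product.\<close>

lemma norm_diff_unit_vector_squared:
  fixes r a :: "complex ^ 'm"
  assumes "norm a = 1"
  defines "h \<equiv> \<Sum>i\<in>UNIV. cnj (a $ i) * r $ i"
  shows "(norm (r - t *s a))\<^sup>2 = (norm r)\<^sup>2 - (cmod h)\<^sup>2 + (cmod (t - h))\<^sup>2"
proof -
  have norm_sq: "(norm v)\<^sup>2 = (\<Sum>i\<in>UNIV. (cmod (v $ i))\<^sup>2)" for v :: "complex ^ 'm"
    by (simp add: norm_vec_def L2_set_def sum_nonneg)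
  have expand: "(cmod (u - v))\<^sup>2 = (cmod u)\<^sup>2 - 2 * Re (cnj v * u) + (cmod v)\<^sup>2" for u v
    unfolding cmod_power2 by (simp add: power2_eq_square algebra_simps)
  have "(norm (r - t *s a))\<^sup>2
      = (\<Sum>i\<in>UNIV. (cmod (r $ i))\<^sup>2 - 2 * Re (cnj t * (cnj (a $ i) * r $ i))
          + (cmod t)\<^sup>2 * (cmod (a $ i))\<^sup>2)"
    by (simp add: norm_sq expand norm_mult power_mult_distrib mult.assoc)
  also have "\<dots> = (norm r)\<^sup>2 - 2 * Re (cnj t * h) + (cmod t)\<^sup>2 * (norm a)\<^sup>2"
    by (simp only: norm_sq h_def sum.distrib sum_subtractf sum_distrib_left Re_sum)
  also have "\<dots> = (norm r)\<^sup>2 - (cmod h)\<^sup>2 + (cmod (t - h))\<^sup>2"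
    using assms(1) expand[of h t] by (simp add: norm_minus_commute)
  finally show ?thesis .
qed

lemma norm_residual_along_axis:
  fixes A :: "complex ^ 'n ^ 'm" and x :: "complex ^ 'n" and y :: "complex ^ 'm"
  assumes "norm (column j A) = 1"
  defines "c \<equiv> (conj_transpose A *v (y - A *v x)) $ j"
  shows "(norm (y - A *v (x + t *s axis j 1)))\<^sup>2
    = (norm (y - A *v x))\<^sup>2 - (cmod c)\<^sup>2 + (cmod (t - c))\<^sup>2"
proof -
  have c: "c = (\<Sum>i\<in>UNIV. cnj (column j A $ i) * (y - A *v x) $ i)"
    by (simp add: c_def conj_transpose_def matrix_vector_mult_def column_def)
  have "A *v axis j 1 = column j A"
    by (simp add: vec_eq_iff matrix_vector_mult_def axis_def column_def if_distrib cong: if_cong)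
  then have "y - A *v (x + t *s axis j 1) = (y - A *v x) - t *s column j A"
    by (simp add: matrix_vector_right_distrib vector_scalar_commute)
  then show ?thesis
    unfolding c by (simp only: norm_diff_unit_vector_squared[OF assms(1)])
qed

lemma weighted_l0_along_axis:
  "weighted_l0 w (x + t *s axis j 1)
    = weighted_l0 w x - (if x $ j \<noteq> 0 then (w $ j)\<^sup>2 else 0)
      + (if x $ j + t \<noteq> 0 then (w $ j)\<^sup>2 else 0)"
proof -
  have split: "weighted_l0 w z
      = (\<Sum>k\<in>supp z - {j}. (w $ k)\<^sup>2) + (if z $ j \<noteq> 0 then (w $ j)\<^sup>2 else 0)" for z
    by (auto simp: weighted_l0_def supp_def sum.remove[where x = j])
  have "supp (x + t *s axis j 1) - {j} = supp x - {j}"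
    by (auto simp: supp_def axis_def)
  then show ?thesis
    using split[of x] split[of "x + t *s axis j 1"] by (simp add: axis_def)
qed

text \<open>The normal equations on the support \<open>S\<close>: a nonzero correlation \<open>c\<close> with an admissible
  column would make the step \<open>c e\<^sub>j\<close> a strict improvement.\<close>

lemma least_squares_orthogonal:
  fixes A :: "complex ^ 'n ^ 'm"
  assumes "norm (column j A) = 1"
    and min: "is_arg_min (\<lambda>z. norm (y - A *v z)) (\<lambda>z. supp z \<subseteq> S) x"
    and "j \<in> S"
  shows "(conj_transpose A *v (y - A *v x)) $ j = 0"
proof -
  define c where "c = (conj_transpose A *v (y - A *v x)) $ j"
  have "supp (x + c *s axis j 1) \<subseteq> insert j (supp x)"
    by (auto simp: supp_def axis_def)
  then have "supp (x + c *s axis j 1) \<subseteq> S"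
    using min \<open>j \<in> S\<close> by (auto simp: is_arg_min_def)
  then have "norm (y - A *v x) \<le> norm (y - A *v (x + c *s axis j 1))"
    using min by (auto simp: is_arg_min_linorder)
  then have "(norm (y - A *v x))\<^sup>2 \<le> (norm (y - A *v (x + c *s axis j 1)))\<^sup>2"
    by (simp add: power_mono)
  also have "\<dots> = (norm (y - A *v x))\<^sup>2 - (cmod c)\<^sup>2"
    using norm_residual_along_axis[OF assms(1), of y x c] by (simp add: c_def)
  finally show ?thesis by (simp add: c_def)
qed

text \<open>The scalar problem solved by hard thresholding.  Nonnegativity of \<open>\<mu>\<close> guarantees that
  whenever the vertex \<open>c\<close> is selected, the entry \<open>b + c\<close> is nonzero and the cost is exactly \<open>\<mu>\<close>.\<close>

lemma hard_threshold_is_arg_min: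
  fixes b c :: complex and \<mu> :: real
  assumes "\<mu> \<ge> 0"
  defines "f \<equiv> \<lambda>t. (cmod (t - c))\<^sup>2 + (if b + t \<noteq> 0 then \<mu> else 0)"
    and "t\<^sub>0 \<equiv> if (cmod (b + c))\<^sup>2 \<le> \<mu> then - b else c"
  shows "f t\<^sub>0 = min ((cmod (b + c))\<^sup>2) \<mu>" and "f t\<^sub>0 \<le> f t"
proof -
  have kill: "(cmod (- b - c))\<^sup>2 = (cmod (b + c))\<^sup>2"
    by (metis minus_diff_commute minus_diff_eq diff_minus_eq_add add.commute norm_minus_cancel)
  show val: "f t\<^sub>0 = min ((cmod (b + c))\<^sup>2) \<mu>"
    using assms(1) kill by (auto simp: f_def t\<^sub>0_def)
  show "f t\<^sub>0 \<le> f t"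
  proof (cases "b + t = 0")
    case True
    then have "t = - b" by (simp add: eq_neg_iff_add_eq_0 add.commute)
    then have "f t = (cmod (b + c))\<^sup>2" by (simp add: f_def kill)
    then show ?thesis by (simp add: val)
  next
    case False
    then have "\<mu> \<le> f t" by (simp add: f_def)
    then show ?thesis by (simp add: val)
  qed
qed

theorem proposition1:
  fixes A :: "complex ^ 'n ^ 'm"
    and y :: "complex ^ 'm"
    and w :: "real ^ 'n"
    and lam :: real
    and S :: "'n set"
    and x :: "complex ^ 'n"
  assumes "\<And>j. w $ j > 0"
    and "lam \<ge> 0"
    and "\<And>j. norm (column j A) = 1"
    and "is_arg_min (\<lambda>z. norm (y - A *v z)) (\<lambda>z. supp z \<subseteq> S) x"
  shows "\<forall>j. \<exists>t\<^sub>0.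
    is_arg_min (\<lambda>t. G A y w lam (x + t *s axis j 1)) (\<lambda>t. True) t\<^sub>0 \<and>
    G A y w lam (x + t\<^sub>0 *s axis j 1) = G A y w lam x - \<Delta> A y w lam x S j"
proof
  fix j
  define c where "c = (conj_transpose A *v (y - A *v x)) $ j"
  define \<mu> where "\<mu> = lam * (w $ j)\<^sup>2"
  define f where "f t = (cmod (t - c))\<^sup>2 + (if x $ j + t \<noteq> 0 then \<mu> else 0)" for t
  define t\<^sub>0 where "t\<^sub>0 = (if (cmod (x $ j + c))\<^sup>2 \<le> \<mu> then - x $ j else c)"
  have "\<mu> \<ge> 0" using assms(2) by (simp add: \<mu>_def)
  note opt = hard_threshold_is_arg_min[OF this, where b = "x $ j" and c = c, folded f_def t\<^sub>0_def]
  have G_line: "G A y w lam (x + t *s axis j 1)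
      = G A y w lam x - (cmod c)\<^sup>2 - (if x $ j \<noteq> 0 then \<mu> else 0) + f t" for t
    unfolding G_def norm_residual_along_axis[OF assms(3)] weighted_l0_along_axis
    by (simp add: c_def \<mu>_def f_def algebra_simps)
  have arg_min: "is_arg_min (\<lambda>t. G A y w lam (x + t *s axis j 1)) (\<lambda>t. True) t\<^sub>0"
    using opt(2) by (simp add: is_arg_min_linorder G_line)
  have "G A y w lam (x + t\<^sub>0 *s axis j 1) = G A y w lam x - \<Delta> A y w lam x S j"
  proof (cases "j \<in> S")
    case True
    then have "c = 0"
      using least_squares_orthogonal[OF assms(3,4)] by (simp add: c_def)
    then show ?thesis
      using True \<open>\<mu> \<ge> 0\<close> opt(1)
      by (auto simp: G_line \<Delta>_def min_def max_def simp flip: \<mu>_def)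
  next
    case False
    then have "x $ j = 0"
      using assms(4) by (auto simp: is_arg_min_def supp_def)
    then show ?thesis
      using False opt(1)
      by (auto simp: G_line \<Delta>_def min_def max_def simp flip: \<mu>_def c_def)
  qed
  with arg_min show "\<exists>t\<^sub>0.
      is_arg_min (\<lambda>t. G A y w lam (x + t *s axis j 1)) (\<lambda>t. True) t\<^sub>0 \<and>
      G A y w lam (x + t\<^sub>0 *s axis j 1) = G A y w lam x - \<Delta> A y w lam x S j"
    by blast
qed

end
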